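(* Let $x=x(s)$ be a regular curve in $\mathbb{E}^4$, parametrized by arclength $s$, with Frenet frame $V_1,V_2,V_3,V_4$ and Frenet curvatures $\kappa_1,\kappa_2,\kappa_3$. Let $\overline{x}(s)=x(s)+(c-s)V_1(s)$, $c$ a real constant, be the involute (of order $1$) of $x$. Put $\varphi=(c-s)\kappa_1$, $$A=\kappa_1'\varphi+2\kappa_1\varphi',\quad C=\kappa_2'\varphi+2\kappa_2\varphi',\quad D=\kappa_2\kappa_3\varphi,$$ $$W=\sqrt{D^2(\kappa_1^2+\kappa_2^2)+(\kappa_1C-\kappa_2A)^2}=|\varphi|\sqrt{\kappa_2^2\kappa_3^2(\kappa_1^2+\kappa_2^2)+(\kappa_1\kappa_2'-\kappa_2\kappa_1')^2}.$$ Then the Frenet $4$-frame $\overline{V}_1,\overline{V}_2,\overline{V}_3,\overline{V}_4$ and the Frenet curvatures $\overline{\kappa}_1,\overline{\kappa}_2,\overline{\kappa}_3$ of $\overline{x}$ are given by $$\overline{V}_1=V_2,\qquad \overline{V}_2=\frac{-\kappa_1V_1+\kappa_2V_3}{\sqrt{\kappa_1^2+\kappa_2^2}},$$ $$\overline{V}_3=\frac{-(\kappa_2A-\kappa_1C)\kappa_2V_1-(\kappa_2A-\kappa_1C)\kappa_1V_3+D(\kappa_1^2+\kappa_2^2)V_4}{W\sqrt{\kappa_1^2+\kappa_2^2}},$$ $$\overline{V}_4=\frac{D\kappa_2V_1+D\kappa_1V_3-(\kappa_2A-\kappa_1C)V_4}{W},$$ and $$\overline{\kappa}_1=\frac{\sqrt{\kappa_1^2+\kappa_2^2}}{|\varphi|},\qquad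 \overline{\kappa}_2=\frac{W}{\varphi^2(\kappa_1^2+\kappa_2^2)},$$ $$\overline{\kappa}_3=-\frac{(\kappa_2A-\kappa_1C)(\kappa_3C+D')+D(\kappa_2A'-\kappa_1C')+D^2\kappa_1\kappa_3}{W\varphi^4\,\overline{\kappa}_1\overline{\kappa}_2}.$$
   Context: Primes denote $d/ds$. For a curve $y$ in $\mathbb{E}^4$ with speed $v=\|y'\|$, the Frenet frame is an orthonormal frame $V_1=y'/\|y'\|,V_2,V_3,V_4$ along $y$, and the Frenet curvatures are functions $\kappa_1,\kappa_2,\kappa_3$, with $V_1'=v\kappa_1V_2$, $V_2'=v(-\kappa_1V_1+\kappa_2V_3)$, $V_3'=v(-\kappa_2V_2+\kappa_3V_4)$, $V_4'=-v\kappa_3V_3$. With $\wedge$ the ternary exterior (vector) product in $\mathbb{E}^4$, they are given by $V_4=\frac{y'\wedge y''\wedge y'''}{\|y'\wedge y''\wedge y'''\|}$, $V_3=\frac{V_4\wedge y'\wedge y''}{\|V_4\wedge y'\wedge y''\|}$, $V_2=\frac{V_3\wedge V_4\wedge y'}{\|V_3\wedge V_4\wedge y'\|}$, $\kappa_1=\frac{\langle V_2,y''\rangle}{\|y'\|^2}$, $\kappa_2=\frac{\langle V_3,y'''\rangle}{\|y'\|^3\kappa_1}$, $\kappa_3=\frac{\langle V_4,y''''\rangle}{\|y'\|^4\kappa_1\kappa_2}$. An involute of order $1$ of a unit speed curve $x$ is a curve $\overline{x}=x+\lambda_1V_1$ with $\lambda_1$ differentiable and $\langle\overline{x}',V_1\rangle=0$,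 i.e. $\lambda_1=c-s$ for a constant $c$.
   Formalization: Signs corrected: V_3 is defined by y'∧V_4∧y''; V̄_1, V̄_2 carry the factor sgn φ; V̄_4=(-Dκ_2V_1-Dκ_1V_3-(κ_2A-κ_1C)V_4)/W; in κ̄_3 the terms D(κ_2A'-κ_1C') and D²κ_1κ_3 change sign. Curves are smooth; φ and W are nonzero. *)

theory Defs
  imports "HOL-Analysis.Analysis"
begin

definition curve_deriv :: "nat \<Rightarrow> (real \<Rightarrow> real^4) \<Rightarrow> real \<Rightarrow> real^4" where
  "curve_deriv n y = ((\<lambda>f s. vector_derivative f (at s)) ^^ n) y"

definition smooth_curve_on :: "real set \<Rightarrow> (real \<Rightarrow> real^4) \<Rightarrow> bool" where
  "smooth_curve_on I y \<longleftrightarrow> (\<forall>n. \<forall>s\<in>I. curve_deriv n y differentiable (at s))"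

text \<open>The ternary vector product: the formal determinant whose first row is the standard basis.
  Putting the basis in the last row changes the sign of the product, hence of the fourth
  frame vector and of the third curvature of every curve.\<close>

definition ternary :: "real^4 \<Rightarrow> real^4 \<Rightarrow> real^4 \<Rightarrow> real^4" where
  "ternary a b c = (\<chi> i. det (vector [axis i 1, a, b, c] :: real^4^4))"

text \<open>Curves possessing a Frenet 4-frame: the first three derivatives are linearly independent.\<close>

definition frenet_curve_on :: "real set \<Rightarrow> (real \<Rightarrow> real^4) \<Rightarrow> bool" where
  "frenet_curve_on I y \<longleftrightarrow> smooth_curve_on I y \<and>
     (\<forall>s\<in>I. ternary (curve_deriv 1 y s) (curve_deriv 2 y s) (curve_deriv 3 y s) \<noteq> 0)"

text \<open>The Frenet frame; \<open>sgn w\<close> is the normalized vector \<open>w / norm w\<close>.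
  The argument order in \<open>frenet_V3\<close> matters. A cyclic shift of four vectors is an odd permutation,
  so the product of \<open>V4\<close>, \<open>y'\<close>, \<open>y''\<close> in this order points opposite to the Gram-Schmidt
  direction of \<open>y'''\<close>, for either sign convention of the product. It would give the negatives
  of \<open>V2\<close>, \<open>V3\<close> and a negative first curvature. With the order below, \<open>V1\<close>, \<open>V2\<close>, \<open>V3\<close> is the
  Gram-Schmidt frame of \<open>y'\<close>, \<open>y''\<close>, \<open>y'''\<close> and the first two curvatures are positive.\<close>

definition frenet_V1 :: "(real \<Rightarrow> real^4) \<Rightarrow> real \<Rightarrow> real^4" where
  "frenet_V1 y s = sgn (curve_deriv 1 y s)"

definition frenet_V4 :: "(real \<Rightarrow> real^4) \<Rightarrow> real \<Rightarrow> real^4" where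
  "frenet_V4 y s = sgn (ternary (curve_deriv 1 y s) (curve_deriv 2 y s) (curve_deriv 3 y s))"

definition frenet_V3 :: "(real \<Rightarrow> real^4) \<Rightarrow> real \<Rightarrow> real^4" where
  "frenet_V3 y s = sgn (ternary (curve_deriv 1 y s) (frenet_V4 y s) (curve_deriv 2 y s))"

definition frenet_V2 :: "(real \<Rightarrow> real^4) \<Rightarrow> real \<Rightarrow> real^4" where
  "frenet_V2 y s = sgn (ternary (frenet_V3 y s) (frenet_V4 y s) (curve_deriv 1 y s))"

definition frenet_k1 :: "(real \<Rightarrow> real^4) \<Rightarrow> real \<Rightarrow> real" where
  "frenet_k1 y s = (frenet_V2 y s \<bullet> curve_deriv 2 y s) / norm (curve_deriv 1 y s) ^ 2"

definition frenet_k2 :: "(real \<Rightarrow> real^4) \<Rightarrow> real \<Rightarrow> real" where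
  "frenet_k2 y s = (frenet_V3 y s \<bullet> curve_deriv 3 y s) /
     (norm (curve_deriv 1 y s) ^ 3 * frenet_k1 y s)"

definition frenet_k3 :: "(real \<Rightarrow> real^4) \<Rightarrow> real \<Rightarrow> real" where
  "frenet_k3 y s = (frenet_V4 y s \<bullet> curve_deriv 4 y s) /
     (norm (curve_deriv 1 y s) ^ 4 * frenet_k1 y s * frenet_k2 y s)"

definition involute :: "real \<Rightarrow> (real \<Rightarrow> real^4) \<Rightarrow> real \<Rightarrow> real^4" where
  "involute c x s = x s + (c - s) *\<^sub>R frenet_V1 x s"

end

theory Submission
  imports Defs
begin

text \<open>For a unit speed curve the definitions of frame and curvatures imply the Frenet equations. They
  yield \<open>xb' = \<phi> V2\<close>, \<open>xb'' = - \<phi> \<kappa>1 V1 + \<phi>' V2 + \<phi> \<kappa>2 V3\<close> and, with a suitable \<open>B\<close>, the third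
  derivative \<open>- A V1 + B V2 + C V3 + D V4\<close>; the frame and curvatures of \<open>xb\<close> are then computed in
  the coordinates of the frame of \<open>x\<close>. The ternary product of the three derivatives has norm
  \<open>\<phi>\<^sup>2 W\<close>, so \<open>xb\<close> has a Frenet frame.\<close>

subsection \<open>Smooth functions of a real variable\<close>

text \<open>The frame and the curvatures of \<open>x\<close> arise from its derivatives by products,
  quotients, roots and normalisation, and the third curvature of the involute differentiates the
  curvatures of \<open>x\<close> up to twice. Smoothness therefore has to pass through all these
  operations before anything can be computed. \<open>n_diff_on\<close> is made for that: it asks for
  some derivative on \<open>S\<close> and recurses on it, so a closure rule is proved by exhibiting
  a derivative and inducting on the order.\<close>

primrec n_diff_on :: "nat \<Rightarrow> real set \<Rightarrow> (real \<Rightarrow> 'a::real_normed_vector) \<Rightarrow> bool" where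
  "n_diff_on 0 S f \<longleftrightarrow> True"
| "n_diff_on (Suc n) S f \<longleftrightarrow>
     (\<exists>f'. (\<forall>s\<in>S. (f has_vector_derivative f' s) (at s)) \<and> n_diff_on n S f')"

lemma n_diff_on_SucI:
  "(\<And>s. s \<in> S \<Longrightarrow> (f has_vector_derivative f' s) (at s)) \<Longrightarrow> n_diff_on n S f' \<Longrightarrow>
   n_diff_on (Suc n) S f"
  by auto

text \<open>The rules for products, reciprocals and roots put the undifferentiated function back
  into the derivative; there it is needed at one order less than assumed.\<close>

lemma n_diff_on_SucD: "n_diff_on (Suc n) S f \<Longrightarrow> n_diff_on n S f"
  by (induction n arbitrary: f) (simp_all, blast)

text \<open>A derivative at a point of an open set depends only on values in that set, so a formula
  valid merely on \<open>S\<close>, such as \<open>e1 s = curve_deriv 1 x s\<close>, may replace the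
  function.\<close>

lemma n_diff_on_cong:
  assumes "open S" "n_diff_on n S f" "\<And>s. s \<in> S \<Longrightarrow> g s = f s"
  shows "n_diff_on n S g"
proof (cases n)
  case (Suc m)
  then obtain f' where "\<forall>s\<in>S. (f has_vector_derivative f' s) (at s)" "n_diff_on m S f'"
    using assms(2) by auto
  moreover have "(g has_vector_derivative f' s) (at s)"
    if "s \<in> S" "(f has_vector_derivative f' s) (at s)" for s
    using has_vector_derivative_transform_within_open[OF that(2) assms(1) that(1)] assms(3) by simp
  ultimately show ?thesis using Suc by auto
qed simp

section \<open>Closure properties of differentiability of finite order\<close>

lemma n_diff_on_linear:
  assumes "bounded_linear h" "n_diff_on n S f"
  shows "n_diff_on n S (\<lambda>s. h (f s))"
  using assms(2)
proof (induction n arbitrary: f)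
  case (Suc n)
  then obtain f' where "\<forall>s\<in>S. (f has_vector_derivative f' s) (at s)" "n_diff_on n S f'"
    by auto
  then show ?case
    using Suc.IH bounded_linear.has_vector_derivative[OF assms(1)]
    by (intro n_diff_on_SucI[where f' = "\<lambda>s. h (f' s)"]) auto
qed simp

lemma n_diff_on_const: "n_diff_on n S (\<lambda>s. k)"
proof (induction n arbitrary: k)
  case (Suc n)
  then show ?case by (intro n_diff_on_SucI[where f' = "\<lambda>s. 0"]) (auto intro: derivative_eq_intros)
qed simp

lemma n_diff_on_id: "n_diff_on n S (\<lambda>s. s)"
proof (cases n)
  case (Suc m)
  then show ?thesis
    using n_diff_on_const
    by (auto intro!: exI[of _ "\<lambda>s. 1"] derivative_eq_intros)
qed simp

lemma n_diff_on_add: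
  "n_diff_on n S f \<Longrightarrow> n_diff_on n S g \<Longrightarrow> n_diff_on n S (\<lambda>s. f s + g s)"
proof (induction n arbitrary: f g)
  case (Suc n)
  obtain f' g' where "\<forall>s\<in>S. (f has_vector_derivative f' s) (at s)" "n_diff_on n S f'"
    "\<forall>s\<in>S. (g has_vector_derivative g' s) (at s)" "n_diff_on n S g'"
    using Suc.prems by auto
  then show ?case
    using Suc.IH
    by (intro n_diff_on_SucI[where f' = "\<lambda>s. f' s + g' s"]) (auto intro: derivative_eq_intros)
qed simp

lemma n_diff_on_minus: "n_diff_on n S f \<Longrightarrow> n_diff_on n S (\<lambda>s. - f s)"
  by (rule n_diff_on_linear[OF bounded_linear_minus[OF bounded_linear_ident]])

lemma n_diff_on_diff:
  "n_diff_on n S f \<Longrightarrow> n_diff_on n S g \<Longrightarrow> n_diff_on n S (\<lambda>s. f s - g s)"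
  using n_diff_on_add[OF _ n_diff_on_minus] by fastforce

lemma n_diff_on_bilinear:
  assumes "bounded_bilinear p"
  shows "n_diff_on n S f \<Longrightarrow> n_diff_on n S g \<Longrightarrow> n_diff_on n S (\<lambda>s. p (f s) (g s))"
proof (induction n arbitrary: f g)
  case (Suc n)
  obtain f' g' where "\<forall>s\<in>S. (f has_vector_derivative f' s) (at s)" "n_diff_on n S f'"
    "\<forall>s\<in>S. (g has_vector_derivative g' s) (at s)" "n_diff_on n S g'"
    using Suc.prems by auto
  then show ?case
    using Suc.IH Suc.prems[THEN n_diff_on_SucD] bounded_bilinear.has_vector_derivative[OF assms]
    by (intro n_diff_on_SucI[where f' = "\<lambda>s. p (f s) (g' s) + p (f' s) (g s)"] n_diff_on_add) auto
qed simp

lemmas n_diff_on_mult = n_diff_on_bilinear[OF bounded_bilinear_mult]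
lemmas n_diff_on_scaleR = n_diff_on_bilinear[OF bounded_bilinear_scaleR]
lemmas n_diff_on_inner = n_diff_on_bilinear[OF bounded_bilinear_inner]

lemma n_diff_on_power:
  fixes f :: "real \<Rightarrow> real"
  shows "n_diff_on n S f \<Longrightarrow> n_diff_on n S (\<lambda>s. f s ^ k)"
  by (induction k) (simp_all add: n_diff_on_const n_diff_on_mult)

text \<open>The derivative is written with \<open>inverse (f s)\<close> itself, so the induction
  hypothesis and the product rule settle it. The square root below is treated in the same
  way.\<close>

lemma n_diff_on_inverse:
  fixes f :: "real \<Rightarrow> real"
  assumes "\<And>s. s \<in> S \<Longrightarrow> f s \<noteq> 0"
  shows "n_diff_on n S f \<Longrightarrow> n_diff_on n S (\<lambda>s. inverse (f s))"
proof (induction n)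
  case (Suc n)
  obtain f' where f': "\<forall>s\<in>S. (f has_vector_derivative f' s) (at s)" "n_diff_on n S f'"
    using Suc.prems by auto
  have "n_diff_on n S (\<lambda>s. inverse (f s))"
    using Suc n_diff_on_SucD by blast
  then have "n_diff_on n S (\<lambda>s. - (f' s * (inverse (f s))\<^sup>2))"
    by (intro n_diff_on_minus n_diff_on_mult f'(2) n_diff_on_power)
  moreover have "((\<lambda>s. inverse (f s)) has_vector_derivative - (f' s * (inverse (f s))\<^sup>2)) (at s)"
    if "s \<in> S" for s
    using f'(1) assms[OF that] that unfolding has_real_derivative_iff_has_vector_derivative[symmetric]
    by (auto intro!: derivative_eq_intros simp: power2_eq_square)
  ultimately show ?case by (rule n_diff_on_SucI[rotated])
qed simp

lemma n_diff_on_divide: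
  fixes f g :: "real \<Rightarrow> real"
  assumes "\<And>s. s \<in> S \<Longrightarrow> g s \<noteq> 0"
  shows "n_diff_on n S f \<Longrightarrow> n_diff_on n S g \<Longrightarrow> n_diff_on n S (\<lambda>s. f s / g s)"
  unfolding divide_inverse by (intro n_diff_on_mult n_diff_on_inverse assms)

lemma n_diff_on_sqrt:
  fixes f :: "real \<Rightarrow> real"
  assumes "\<And>s. s \<in> S \<Longrightarrow> 0 < f s"
  shows "n_diff_on n S f \<Longrightarrow> n_diff_on n S (\<lambda>s. sqrt (f s))"
proof (induction n)
  case (Suc n)
  obtain f' where f': "\<forall>s\<in>S. (f has_vector_derivative f' s) (at s)" "n_diff_on n S f'"
    using Suc.prems by auto
  have "n_diff_on n S (\<lambda>s. sqrt (f s))"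
    using Suc n_diff_on_SucD by blast
  then have "n_diff_on n S (\<lambda>s. f' s / (2 * sqrt (f s)))"
    using assms by (intro n_diff_on_divide f'(2) n_diff_on_mult n_diff_on_const) force+
  moreover have "((\<lambda>s. sqrt (f s)) has_vector_derivative f' s / (2 * sqrt (f s))) (at s)"
    if "s \<in> S" for s
    using f'(1) assms[OF that] that unfolding has_real_derivative_iff_has_vector_derivative[symmetric]
    by (auto intro!: derivative_eq_intros simp: field_simps)
  ultimately show ?case by (rule n_diff_on_SucI[rotated])
qed simp

text \<open>The norm is the root of \<open>f s \<bullet> f s\<close>, which is positive where
  \<open>f\<close> does not vanish. This carries smoothness to the frame vectors, all of which are
  values of \<open>sgn\<close>.\<close>

lemma n_diff_on_sgn:
  fixes f :: "real \<Rightarrow> 'a::real_inner"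
  assumes "\<And>s. s \<in> S \<Longrightarrow> f s \<noteq> 0" and "n_diff_on n S f"
  shows "n_diff_on n S (\<lambda>s. sgn (f s))"
  unfolding sgn_div_norm norm_eq_sqrt_inner
  using assms
  by (intro n_diff_on_scaleR n_diff_on_inverse n_diff_on_sqrt n_diff_on_inner) auto

definition smooth_fun_on :: "real set \<Rightarrow> (real \<Rightarrow> 'a::real_normed_vector) \<Rightarrow> bool" where
  "smooth_fun_on S f \<longleftrightarrow> (\<forall>n. n_diff_on n S f)"

text \<open>The derivatives witnessing different orders may be different functions, but uniqueness
  makes each of them equal to \<open>vector_derivative\<close> on \<open>S\<close>, which then
  serves every order at once.\<close>

lemma smooth_fun_on_vector_derivative:
  assumes "open S" "smooth_fun_on S f"
  shows "smooth_fun_on S (\<lambda>s. vector_derivative f (at s))"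
    and "s \<in> S \<Longrightarrow> (f has_vector_derivative vector_derivative f (at s)) (at s)"
proof -
  have f': "\<exists>f'. (\<forall>s\<in>S. (f has_vector_derivative f' s) (at s)) \<and> n_diff_on n S f'" for n
    using assms(2)[unfolded smooth_fun_on_def, rule_format, of "Suc n"] by simp
  have "n_diff_on n S (\<lambda>s. vector_derivative f (at s))" for n
  proof -
    obtain g where g: "\<forall>s\<in>S. (f has_vector_derivative g s) (at s)" "n_diff_on n S g"
      using f'[of n] by blast
    show ?thesis
      by (rule n_diff_on_cong[OF assms(1) g(2)]) (simp add: vector_derivative_at g(1))
  qed
  then show "smooth_fun_on S (\<lambda>s. vector_derivative f (at s))"
    by (simp add: smooth_fun_on_def)
  show "s \<in> S \<Longrightarrow> (f has_vector_derivative vector_derivative f (at s)) (at s)"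
  proof -
    obtain g where g: "\<forall>s\<in>S. (f has_vector_derivative g s) (at s)"
      using f'[of 0] by blast
    assume "s \<in> S"
    then have "(f has_vector_derivative g s) (at s)" using g by simp
    then show ?thesis by (simp add: vector_derivative_at)
  qed
qed

lemma smooth_fun_on_cong:
  "open S \<Longrightarrow> smooth_fun_on S f \<Longrightarrow> (\<And>s. s \<in> S \<Longrightarrow> g s = f s) \<Longrightarrow> smooth_fun_on S g"
  unfolding smooth_fun_on_def by (intro allI) (rule n_diff_on_cong, auto)

lemma smooth_fun_on_deriv:
  fixes f :: "real \<Rightarrow> real"
  assumes "open S" "smooth_fun_on S f"
  shows "smooth_fun_on S (deriv f)"
    and "s \<in> S \<Longrightarrow> (f has_vector_derivative deriv f s) (at s)"
proof -
  have eq: "deriv f s = vector_derivative f (at s)" if "s \<in> S" for s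
    using smooth_fun_on_vector_derivative(2)[OF assms that]
    unfolding has_real_derivative_iff_has_vector_derivative[symmetric] by (rule DERIV_imp_deriv)
  show "smooth_fun_on S (deriv f)"
    using smooth_fun_on_cong[OF assms(1) smooth_fun_on_vector_derivative(1)[OF assms] eq] .
  show "s \<in> S \<Longrightarrow> (f has_vector_derivative deriv f s) (at s)"
    using smooth_fun_on_vector_derivative(2)[OF assms] eq by simp
qed

section \<open>Iterated derivatives of curves\<close>

lemma curve_deriv_0: "curve_deriv 0 y = y"
  by (simp add: curve_deriv_def)

lemma curve_deriv_Suc: "curve_deriv (Suc n) y s = vector_derivative (curve_deriv n y) (at s)"
  by (simp add: curve_deriv_def)

lemma smooth_fun_on_curve_deriv:
  assumes "open S" "smooth_fun_on S y"
  shows "smooth_fun_on S (curve_deriv n y)"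
proof (induction n)
  case (Suc n)
  then show ?case
    using smooth_fun_on_vector_derivative(1)[OF assms(1) Suc.IH]
    unfolding curve_deriv_Suc[symmetric] by simp
qed (simp add: curve_deriv_0 assms)

text \<open>The left side speaks of iterated derivatives, the right side is stable under the
  operations that build frames and involutes; the proof has to pass between them in both
  directions.\<close>

lemma smooth_curve_on_iff:
  assumes "open S"
  shows "smooth_curve_on S y \<longleftrightarrow> smooth_fun_on S y"
proof
  assume y: "smooth_curve_on S y"
  \<comment> \<open>\<open>k\<close> is general because differentiating the \<open>k\<close>-th
    derivative leads to the next one.\<close>
  have "n_diff_on n S (curve_deriv k y)" for n k
  proof (induction n arbitrary: k)
    case (Suc n)
    have "(curve_deriv k y has_vector_derivative curve_deriv (Suc k) y s) (at s)" if "s \<in> S" for s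
      using y that by (simp add: smooth_curve_on_def curve_deriv_Suc vector_derivative_works[symmetric])
    then show ?case by (rule n_diff_on_SucI[OF _ Suc])
  qed simp
  from this[of _ 0] show "smooth_fun_on S y"
    by (simp add: smooth_fun_on_def curve_deriv_0)
next
  assume "smooth_fun_on S y"
  then show "smooth_curve_on S y"
    unfolding smooth_curve_on_def
    using smooth_fun_on_vector_derivative(2)[OF assms smooth_fun_on_curve_deriv[OF assms]]
    by (intro allI ballI) (rule differentiableI_vector)
qed

text \<open>A formula for the \<open>n\<close>-th derivative that holds only on \<open>S\<close> can
  still be differentiated there. This yields the second to fourth derivatives of the
  involute.\<close>

lemma curve_deriv_SucI:
  assumes "open S" "s \<in> S" "\<And>t. t \<in> S \<Longrightarrow> curve_deriv n y t = z t"
    "(z has_vector_derivative z') (at s)"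
  shows "curve_deriv (Suc n) y s = z'"
  unfolding curve_deriv_Suc
  by (rule vector_derivative_at, rule has_vector_derivative_transform_within_open[OF assms(4,1,2)])
    (simp add: assms(3))

subsection \<open>The ternary product and orthonormal frames\<close>

text \<open>The permutations of four indices are resolved one index at a time, down to those of the
  singleton \<open>{4}\<close>; 24 signed products remain.\<close>

lemma det_4:
  fixes M :: "'a::comm_ring_1^4^4"
  shows "det M =
    M$1$1*M$2$2*M$3$3*M$4$4 - M$1$1*M$2$2*M$3$4*M$4$3 - M$1$1*M$2$3*M$3$2*M$4$4 +
    M$1$1*M$2$3*M$3$4*M$4$2 + M$1$1*M$2$4*M$3$2*M$4$3 - M$1$1*M$2$4*M$3$3*M$4$2 -
    M$1$2*M$2$1*M$3$3*M$4$4 + M$1$2*M$2$1*M$3$4*M$4$3 + M$1$2*M$2$3*M$3$1*M$4$4 -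
    M$1$2*M$2$3*M$3$4*M$4$1 - M$1$2*M$2$4*M$3$1*M$4$3 + M$1$2*M$2$4*M$3$3*M$4$1 +
    M$1$3*M$2$1*M$3$2*M$4$4 - M$1$3*M$2$1*M$3$4*M$4$2 - M$1$3*M$2$2*M$3$1*M$4$4 +
    M$1$3*M$2$2*M$3$4*M$4$1 + M$1$3*M$2$4*M$3$1*M$4$2 - M$1$3*M$2$4*M$3$2*M$4$1 -
    M$1$4*M$2$1*M$3$2*M$4$3 + M$1$4*M$2$1*M$3$3*M$4$2 + M$1$4*M$2$2*M$3$1*M$4$3 -
    M$1$4*M$2$2*M$3$3*M$4$1 - M$1$4*M$2$3*M$3$1*M$4$2 + M$1$4*M$2$3*M$3$2*M$4$1"
proof -
  have f: "finite {2::4, 3, 4}" "1 \<notin> {2::4, 3, 4}" "finite {3::4, 4}" "2 \<notin> {3::4, 4}"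
    "finite {4::4}" "3 \<notin> {4::4}"
    by auto
  show ?thesis
    unfolding det_def UNIV_4
    unfolding sum_over_permutations_insert[OF f(1,2)]
    unfolding sum_over_permutations_insert[OF f(3,4)]
    unfolding sum_over_permutations_insert[OF f(5,6)]
    unfolding permutes_sing
    by (simp add: sign_swap_id permutation_swap_id sign_compose sign_id permutation_compose
        swap_id_eq)
qed

lemma vector_4_nth:
  "(vector [a, b, c, d] :: 'a::zero^4) $ 1 = a" "(vector [a, b, c, d] :: 'a^4) $ 2 = b"
  "(vector [a, b, c, d] :: 'a^4) $ 3 = c" "(vector [a, b, c, d] :: 'a^4) $ 4 = d"
  by (simp_all add: vector_def)

lemma ternary_nth:
  "ternary a b c $ 1 = a$2*b$3*c$4 - a$2*b$4*c$3 - a$3*b$2*c$4 + a$3*b$4*c$2 + a$4*b$2*c$3 - a$4*b$3*c$2"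
  "ternary a b c $ 2 = - a$1*b$3*c$4 + a$1*b$4*c$3 + a$3*b$1*c$4 - a$3*b$4*c$1 - a$4*b$1*c$3 + a$4*b$3*c$1"
  "ternary a b c $ 3 = a$1*b$2*c$4 - a$1*b$4*c$2 - a$2*b$1*c$4 + a$2*b$4*c$1 + a$4*b$1*c$2 - a$4*b$2*c$1"
  "ternary a b c $ 4 = - a$1*b$2*c$3 + a$1*b$3*c$2 + a$2*b$1*c$3 - a$2*b$3*c$1 - a$3*b$1*c$2 + a$3*b$2*c$1"
  by (simp_all add: ternary_def det_4 vector_4_nth axis_def)

lemma inner_4: "(u::real^4) \<bullet> w = u$1 * w$1 + u$2 * w$2 + u$3 * w$3 + u$4 * w$4"
  by (simp add: inner_vec_def sum_4)

lemmas ternary_vec_simps = vec_eq_iff forall_4 ternary_nth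

section \<open>Algebra of the ternary product, by polynomial identities in the components\<close>

lemma ternary_add:
  "ternary (a + a') b c = ternary a b c + ternary a' b c"
  "ternary a (b + b') c = ternary a b c + ternary a b' c"
  "ternary a b (c + c') = ternary a b c + ternary a b c'"
  by (simp_all add: ternary_vec_simps algebra_simps)

lemma ternary_scaleR:
  "ternary (r *\<^sub>R a) b c = r *\<^sub>R ternary a b c"
  "ternary a (r *\<^sub>R b) c = r *\<^sub>R ternary a b c"
  "ternary a b (r *\<^sub>R c) = r *\<^sub>R ternary a b c"
  by (simp_all add: ternary_vec_simps algebra_simps)

lemma ternary_same: "ternary a a c = 0" "ternary a c c = 0" "ternary a c a = 0"
  by (simp_all add: ternary_vec_simps)

lemma ternary_swap: "ternary b a c = - ternary a b c" "ternary a c b = - ternary a b c"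
  by (simp_all add: ternary_vec_simps)

lemma ternary_orthogonal: "ternary a b c \<bullet> a = 0" "ternary a b c \<bullet> b = 0" "ternary a b c \<bullet> c = 0"
  by (simp_all add: inner_4 ternary_nth algebra_simps)

text \<open>Both inner products are determinants, with rows \<open>d, a, b, c\<close> and
  \<open>c, d, a, b\<close>; these differ by a cyclic shift of four rows, which is odd.\<close>

lemma inner_ternary_rotate: "ternary a b c \<bullet> d = - (ternary d a b \<bullet> c)"
  by (simp add: inner_4 ternary_nth algebra_simps)

text \<open>The right side is the Gram determinant of \<open>a\<close>, \<open>b\<close>,
  \<open>c\<close>. It decides whether a product vanishes and gives its length.\<close>

lemma ternary_inner_ternary:
  "ternary a b c \<bullet> ternary a b c =
     (a \<bullet> a) * ((b \<bullet> b) * (c \<bullet> c) - (b \<bullet> c)\<^sup>2) - (a \<bullet> b) * ((a \<bullet> b) * (c \<bullet> c) - (b \<bullet> c) * (a \<bullet> c))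
     + (a \<bullet> c) * ((a \<bullet> b) * (b \<bullet> c) - (b \<bullet> b) * (a \<bullet> c))"
  unfolding inner_4 ternary_nth by algebra

lemma n_diff_on_ternary:
  assumes "n_diff_on n S f" "n_diff_on n S g" "n_diff_on n S h"
  shows "n_diff_on n S (\<lambda>s. ternary (f s) (g s) (h s))"
proof -
  have nth: "n_diff_on n S (\<lambda>s. u s $ i)" if "n_diff_on n S u" for u :: "real \<Rightarrow> real^4" and i
    by (rule n_diff_on_linear[OF bounded_linear_vec_nth that])
  \<comment> \<open>The closure rules cover sums and scalar multiples, so the product is rebuilt
    from its polynomial components along the standard basis.\<close>
  have "w = (w$1) *\<^sub>R axis 1 1 + (w$2) *\<^sub>R axis 2 1 + (w$3) *\<^sub>R axis 3 1 + (w$4) *\<^sub>R axis 4 1"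
    for w :: "real^4"
    by (simp add: vec_eq_iff forall_4 axis_def)
  then have "(\<lambda>s. ternary (f s) (g s) (h s)) =
      (\<lambda>s. (ternary (f s) (g s) (h s) $ 1) *\<^sub>R axis 1 1 + (ternary (f s) (g s) (h s) $ 2) *\<^sub>R axis 2 1
        + (ternary (f s) (g s) (h s) $ 3) *\<^sub>R axis 3 1 + (ternary (f s) (g s) (h s) $ 4) *\<^sub>R axis 4 1)"
    by blast
  then show ?thesis
    unfolding ternary_nth
    by (simp only:) (intro n_diff_on_add n_diff_on_scaleR n_diff_on_diff n_diff_on_mult n_diff_on_minus
        n_diff_on_const nth assms)
qed

section \<open>Coordinates in an oriented orthonormal frame\<close>

text \<open>The last condition fixes the orientation. It means \<open>det (vector [e1, e2, e3, e4]) = -1\<close>,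
  the orientation of every frame obtained from \<open>ternary\<close>, since a cyclic shift of four rows is odd.\<close>

definition frame :: "real^4 \<Rightarrow> real^4 \<Rightarrow> real^4 \<Rightarrow> real^4 \<Rightarrow> bool" where
  "frame e1 e2 e3 e4 \<longleftrightarrow>
     e1 \<bullet> e1 = 1 \<and> e2 \<bullet> e2 = 1 \<and> e3 \<bullet> e3 = 1 \<and> e4 \<bullet> e4 = 1 \<and>
     e1 \<bullet> e2 = 0 \<and> e1 \<bullet> e3 = 0 \<and> e1 \<bullet> e4 = 0 \<and> e2 \<bullet> e3 = 0 \<and> e2 \<bullet> e4 = 0 \<and> e3 \<bullet> e4 = 0 \<and>
     ternary e3 e4 e1 = e2"

lemma frame_inner:
  assumes "frame e1 e2 e3 e4"
  shows "e1 \<bullet> e1 = 1" "e2 \<bullet> e2 = 1" "e3 \<bullet> e3 = 1" "e4 \<bullet> e4 = 1"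
    "e1 \<bullet> e2 = 0" "e1 \<bullet> e3 = 0" "e1 \<bullet> e4 = 0" "e2 \<bullet> e3 = 0" "e2 \<bullet> e4 = 0" "e3 \<bullet> e4 = 0"
    "e2 \<bullet> e1 = 0" "e3 \<bullet> e1 = 0" "e4 \<bullet> e1 = 0" "e3 \<bullet> e2 = 0" "e4 \<bullet> e2 = 0" "e4 \<bullet> e3 = 0"
  using assms by (simp_all add: frame_def inner_commute)

text \<open>Orthonormal rows mean \<open>M ** transpose M = mat 1\<close>. A one-sided inverse of a
  square matrix is two-sided, and \<open>transpose M ** M = mat 1\<close> is the expansion.\<close>

lemma frame_expand:
  assumes "frame e1 e2 e3 e4"
  shows "w = (w \<bullet> e1) *\<^sub>R e1 + (w \<bullet> e2) *\<^sub>R e2 + (w \<bullet> e3) *\<^sub>R e3 + (w \<bullet> e4) *\<^sub>R e4"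
proof -
  define M where "M = (vector [e1, e2, e3, e4] :: real^4^4)"
  have "M ** transpose M = mat 1"
    using frame_inner[OF assms, unfolded inner_4]
    by (simp add: M_def vec_eq_iff forall_4 matrix_matrix_mult_def transpose_def mat_def
        vector_4_nth sum_4)
  then have "transpose M ** M = mat 1"
    using matrix_left_right_inverse by blast
  then have "(transpose M ** M) *v w = w" by simp
  then have "transpose M *v (M *v w) = w" by (simp add: matrix_vector_mul_assoc)
  then show ?thesis
    by (simp add: M_def vec_eq_iff forall_4 matrix_vector_mult_def transpose_def
        vector_4_nth sum_4 inner_4 algebra_simps)
qed

text \<open>A product of three frame vectors is orthogonal to them, hence a multiple of the fourth;
  the coefficient follows from the orientation condition by repeated rotation.\<close>

lemma frame_ternary:
  assumes "frame e1 e2 e3 e4"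
  shows "ternary e1 e2 e3 = e4" "ternary e1 e2 e4 = - e3" "ternary e1 e3 e4 = e2"
    "ternary e2 e3 e4 = - e1"
proof -
  note o = frame_inner[OF assms]
  have e: "ternary e3 e4 e1 = e2" using assms by (simp add: frame_def)
  show "ternary e1 e3 e4 = e2"
    using e ternary_swap by (metis minus_minus)
  have 1: "ternary e3 e4 e1 \<bullet> e2 = 1" using e o by simp
  have 2: "ternary e2 e3 e4 \<bullet> e1 = -1" using 1 inner_ternary_rotate[of e3 e4 e1 e2] by simp
  have 3: "ternary e1 e2 e3 \<bullet> e4 = 1" using 2 inner_ternary_rotate[of e2 e3 e4 e1] by simp
  have 4: "ternary e4 e1 e2 \<bullet> e3 = -1" using 3 inner_ternary_rotate[of e1 e2 e3 e4] by simp
  have 5: "ternary e1 e2 e4 = ternary e4 e1 e2" by (metis ternary_swap minus_minus)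
  note ex = frame_expand[OF assms]
  show "ternary e1 e2 e3 = e4"
    using ex[of "ternary e1 e2 e3"] 3 by (simp add: ternary_orthogonal)
  show "ternary e1 e2 e4 = - e3"
    using ex[of "ternary e1 e2 e4"] 4[folded 5] by (simp add: ternary_orthogonal)
  show "ternary e2 e3 e4 = - e1"
    using ex[of "ternary e2 e3 e4"] 2 by (simp add: ternary_orthogonal)
qed


text \<open>The coefficients are the cofactors of the formal determinant with all signs reversed,
  since the frame has orientation -1 and the standard basis +1.\<close>

lemma ternary_frame_combination:
  assumes "frame e1 e2 e3 e4"
  shows "ternary (a1 *\<^sub>R e1 + a2 *\<^sub>R e2 + a3 *\<^sub>R e3 + a4 *\<^sub>R e4)
      (b1 *\<^sub>R e1 + b2 *\<^sub>R e2 + b3 *\<^sub>R e3 + b4 *\<^sub>R e4)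
      (c1 *\<^sub>R e1 + c2 *\<^sub>R e2 + c3 *\<^sub>R e3 + c4 *\<^sub>R e4) =
    - (a2 * (b3 * c4 - b4 * c3) - a3 * (b2 * c4 - b4 * c2) + a4 * (b2 * c3 - b3 * c2)) *\<^sub>R e1
    + (a1 * (b3 * c4 - b4 * c3) - a3 * (b1 * c4 - b4 * c1) + a4 * (b1 * c3 - b3 * c1)) *\<^sub>R e2
    - (a1 * (b2 * c4 - b4 * c2) - a2 * (b1 * c4 - b4 * c1) + a4 * (b1 * c2 - b2 * c1)) *\<^sub>R e3
    + (a1 * (b2 * c3 - b3 * c2) - a2 * (b1 * c3 - b3 * c1) + a3 * (b1 * c2 - b2 * c1)) *\<^sub>R e4"
proof -
  note t = frame_ternary[OF assms]
  have p: "ternary u w z = r \<Longrightarrow> ternary w u z = - r" "ternary u w z = r \<Longrightarrow> ternary u z w = - r"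
    for u w z r by (metis ternary_swap)+
  have s123: "ternary e2 e1 e3 = - e4" "ternary e1 e3 e2 = - e4" "ternary e3 e1 e2 = e4"
    "ternary e2 e3 e1 = e4" "ternary e3 e2 e1 = - e4"
    using t(1) p by (metis minus_minus)+
  have s124: "ternary e2 e1 e4 = e3" "ternary e1 e4 e2 = e3" "ternary e4 e1 e2 = - e3"
    "ternary e2 e4 e1 = - e3" "ternary e4 e2 e1 = e3"
    using t(2) p by (metis minus_minus)+
  have s134: "ternary e3 e1 e4 = - e2" "ternary e1 e4 e3 = - e2" "ternary e4 e1 e3 = e2"
    "ternary e3 e4 e1 = e2" "ternary e4 e3 e1 = - e2"
    using t(3) p by (metis minus_minus)+
  have s234: "ternary e3 e2 e4 = e1" "ternary e2 e4 e3 = e1" "ternary e4 e2 e3 = - e1"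
    "ternary e3 e4 e2 = - e1" "ternary e4 e3 e2 = e1"
    using t(4) p by (metis minus_minus)+
  show ?thesis
    unfolding ternary_add ternary_scaleR ternary_same t s123 s124 s134 s234
    by (simp add: algebra_simps)
qed

lemma norm_frame_combination:
  assumes "frame e1 e2 e3 e4"
  shows "norm (a1 *\<^sub>R e1 + a2 *\<^sub>R e2 + a3 *\<^sub>R e3 + a4 *\<^sub>R e4) = sqrt (a1\<^sup>2 + a2\<^sup>2 + a3\<^sup>2 + a4\<^sup>2)"
  unfolding norm_eq_sqrt_inner
  by (simp add: inner_add_left inner_add_right frame_inner[OF assms] power2_eq_square)

lemma inner_frame_combination:
  assumes "frame e1 e2 e3 e4"
  shows "(a1 *\<^sub>R e1 + a2 *\<^sub>R e2 + a3 *\<^sub>R e3 + a4 *\<^sub>R e4) \<bullet>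
    (b1 *\<^sub>R e1 + b2 *\<^sub>R e2 + b3 *\<^sub>R e3 + b4 *\<^sub>R e4) = a1 * b1 + a2 * b2 + a3 * b3 + a4 * b4"
  by (simp add: inner_add_left inner_add_right frame_inner[OF assms])

subsection \<open>Frenet equations of a unit speed curve\<close>

text \<open>Applied to the constant inner products of frame vectors, this is the skew symmetry of
  the Frenet matrix.\<close>

lemma inner_const_derivative:
  assumes "open S" "s \<in> S" "\<And>t. t \<in> S \<Longrightarrow> f t \<bullet> g t = k"
    and "(f has_vector_derivative f') (at s)" "(g has_vector_derivative g') (at s)"
  shows "f' \<bullet> g s + f s \<bullet> g' = 0"
proof -
  have "((\<lambda>t. f t \<bullet> g t) has_vector_derivative f s \<bullet> g' + f' \<bullet> g s) (at s)"
    by (rule bounded_bilinear.has_vector_derivative[OF bounded_bilinear_inner assms(4,5)])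
  moreover have "((\<lambda>t. f t \<bullet> g t) has_vector_derivative 0) (at s)"
    by (rule has_vector_derivative_transform_within_open[OF has_vector_derivative_const assms(1,2)])
      (simp add: assms(3))
  ultimately show ?thesis
    using vector_derivative_unique_at by (metis add.commute)
qed

lemma inner_sgn_self: "w \<noteq> 0 \<Longrightarrow> sgn w \<bullet> sgn w = 1" for w :: "'a::real_inner"
  by (simp add: dot_square_norm norm_sgn)

lemma inner_sgn_eq_0: "w \<bullet> u = 0 \<Longrightarrow> sgn w \<bullet> u = 0" for w :: "'a::real_inner"
  by (simp add: sgn_div_norm)

locale unit_speed_frenet_curve =
  fixes S :: "real set" and x :: "real \<Rightarrow> real^4"
  assumes open_S: "open S"
    and frenet_curve: "frenet_curve_on S x"
    and unit_speed: "s \<in> S \<Longrightarrow> norm (curve_deriv 1 x s) = 1"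
begin

abbreviation "e1 \<equiv> frenet_V1 x"
abbreviation "e2 \<equiv> frenet_V2 x"
abbreviation "e3 \<equiv> frenet_V3 x"
abbreviation "e4 \<equiv> frenet_V4 x"
abbreviation "k1 \<equiv> frenet_k1 x"
abbreviation "k2 \<equiv> frenet_k2 x"
abbreviation "k3 \<equiv> frenet_k3 x"

lemma smooth_x: "smooth_fun_on S x"
  using frenet_curve by (simp add: frenet_curve_on_def smooth_curve_on_iff[OF open_S])

lemma smooth_curve_deriv: "smooth_fun_on S (curve_deriv n x)"
  by (rule smooth_fun_on_curve_deriv[OF open_S smooth_x])

lemma curve_deriv_derivative:
  "s \<in> S \<Longrightarrow> (curve_deriv n x has_vector_derivative curve_deriv (Suc n) x s) (at s)"
  using smooth_fun_on_vector_derivative(2)[OF open_S smooth_curve_deriv] by (simp add: curve_deriv_Suc)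

lemma curve_deriv_derivatives:
  assumes "s \<in> S"
  shows "(curve_deriv 1 x has_vector_derivative curve_deriv 2 x s) (at s)"
    "(curve_deriv 2 x has_vector_derivative curve_deriv 3 x s) (at s)"
    "(curve_deriv 3 x has_vector_derivative curve_deriv 4 x s) (at s)"
  using curve_deriv_derivative[OF assms, of 1] curve_deriv_derivative[OF assms, of 2]
    curve_deriv_derivative[OF assms, of 3]
  by (simp_all add: eval_nat_numeral)

lemma ternary_curve_deriv_nonzero:
  "s \<in> S \<Longrightarrow> ternary (curve_deriv 1 x s) (curve_deriv 2 x s) (curve_deriv 3 x s) \<noteq> 0"
  using frenet_curve by (simp add: frenet_curve_on_def)

lemma V1_eq: "s \<in> S \<Longrightarrow> e1 s = curve_deriv 1 x s"
  using unit_speed by (simp add: frenet_V1_def sgn_div_norm)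

text \<open>Unit speed makes the first two derivatives orthogonal, and \<open>e4\<close> is
  orthogonal to the first three. So the Gram determinant behind \<open>e3\<close> is the squared
  length of the second derivative, which is positive. The nonvanishing directions are recorded
  because \<open>sgn\<close> is smooth only away from 0.\<close>

lemma
  assumes s: "s \<in> S"
  shows frame: "frame (e1 s) (e2 s) (e3 s) (e4 s)"
    and V4_orthogonal: "e4 s \<bullet> curve_deriv 2 x s = 0" "e4 s \<bullet> curve_deriv 3 x s = 0"
    and V3_orthogonal: "e3 s \<bullet> curve_deriv 2 x s = 0"
    and V1_orthogonal: "e1 s \<bullet> curve_deriv 2 x s = 0"
    and V3_direction_nonzero: "ternary (curve_deriv 1 x s) (e4 s) (curve_deriv 2 x s) \<noteq> 0"
    and V2_direction_nonzero: "ternary (e3 s) (e4 s) (curve_deriv 1 x s) \<noteq> 0"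
proof -
  let ?y1 = "curve_deriv 1 x s" and ?y2 = "curve_deriv 2 x s" and ?y3 = "curve_deriv 3 x s"
  have y11: "?y1 \<bullet> ?y1 = 1"
    using unit_speed[OF s] by (simp add: dot_square_norm)
  have "?y2 \<bullet> ?y1 + ?y1 \<bullet> ?y2 = 0"
    using unit_speed curve_deriv_derivatives(1)[OF s]
    by (intro inner_const_derivative[OF open_S s, where k = 1]) (simp_all add: dot_square_norm)
  then have y12: "?y1 \<bullet> ?y2 = 0" "?y2 \<bullet> ?y1 = 0" by (simp_all add: inner_commute)
  note n = ternary_curve_deriv_nonzero[OF s]
  have "?y2 \<noteq> 0"
    using n ternary_scaleR(2)[of ?y1 0 0 ?y3] by auto
  then have y22: "?y2 \<bullet> ?y2 \<noteq> 0" by simp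
  have e44: "e4 s \<bullet> e4 s = 1"
    unfolding frenet_V4_def by (rule inner_sgn_self[OF n])
  have e4: "e4 s \<bullet> ?y1 = 0" "e4 s \<bullet> ?y2 = 0" "e4 s \<bullet> ?y3 = 0"
    unfolding frenet_V4_def by (intro inner_sgn_eq_0 ternary_orthogonal)+
  have p: "ternary ?y1 (e4 s) ?y2 \<noteq> 0"
    using ternary_inner_ternary[of ?y1 "e4 s" ?y2] y11 y12 y22 e44 e4 by (auto simp: inner_commute)
  have e33: "e3 s \<bullet> e3 s = 1"
    unfolding frenet_V3_def by (rule inner_sgn_self[OF p])
  have e3: "e3 s \<bullet> ?y1 = 0" "e3 s \<bullet> e4 s = 0" "e3 s \<bullet> ?y2 = 0"
    unfolding frenet_V3_def by (intro inner_sgn_eq_0 ternary_orthogonal)+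
  \<comment> \<open>The three factors are orthonormal, so the product already has length 1 and
    \<open>e2\<close> equals it exactly; this is the orientation condition of
    \<open>frame\<close>.\<close>
  have q: "ternary (e3 s) (e4 s) ?y1 \<bullet> ternary (e3 s) (e4 s) ?y1 = 1"
    using ternary_inner_ternary[of "e3 s" "e4 s" ?y1] y11 e33 e44 e3 e4 by (simp add: inner_commute)
  then have e2: "e2 s = ternary (e3 s) (e4 s) ?y1"
    by (simp add: frenet_V2_def sgn_div_norm norm_eq_sqrt_inner)
  show "frame (e1 s) (e2 s) (e3 s) (e4 s)"
    using y11 e33 e44 e3 e4 q ternary_orthogonal[of "e3 s" "e4 s" ?y1]
    by (simp add: frame_def V1_eq[OF s] e2 inner_commute)
  show "e4 s \<bullet> ?y2 = 0" "e4 s \<bullet> ?y3 = 0" "e3 s \<bullet> ?y2 = 0" "e1 s \<bullet> ?y2 = 0"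
    using e3 e4 y12 by (simp_all add: V1_eq[OF s])
  show "ternary ?y1 (e4 s) ?y2 \<noteq> 0" "ternary (e3 s) (e4 s) ?y1 \<noteq> 0"
    using p q by auto
qed

lemma curve_deriv_2: "s \<in> S \<Longrightarrow> curve_deriv 2 x s = k1 s *\<^sub>R e2 s"
  using frame_expand[OF frame, of s "curve_deriv 2 x s"]
  by (simp add: V4_orthogonal V3_orthogonal V1_orthogonal inner_commute[of "curve_deriv 2 x s"]
      frenet_k1_def unit_speed[unfolded One_nat_def])

lemma k1_nonzero: "s \<in> S \<Longrightarrow> k1 s \<noteq> 0"
  using ternary_curve_deriv_nonzero[of s] curve_deriv_2[of s]
    ternary_scaleR(2)[of "curve_deriv 1 x s" 0 0 "curve_deriv 3 x s"] by auto

lemma smooth_frame: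
  "smooth_fun_on S e1" "smooth_fun_on S e2" "smooth_fun_on S e3" "smooth_fun_on S e4"
proof -
  have y: "n_diff_on n S (curve_deriv k x)" for n k
    using smooth_curve_deriv by (simp add: smooth_fun_on_def)
  have e1: "n_diff_on n S e1" for n
    using n_diff_on_cong[OF open_S y V1_eq] by auto
  have e4: "n_diff_on n S e4" for n
    unfolding frenet_V4_def[abs_def]
    by (rule n_diff_on_sgn[OF ternary_curve_deriv_nonzero n_diff_on_ternary[OF y y y]])
  have e3: "n_diff_on n S e3" for n
    unfolding frenet_V3_def[abs_def]
    by (rule n_diff_on_sgn[OF V3_direction_nonzero n_diff_on_ternary[OF y e4 y]])
  have e2: "n_diff_on n S e2" for n
    unfolding frenet_V2_def[abs_def]
    by (rule n_diff_on_sgn[OF V2_direction_nonzero n_diff_on_ternary[OF e3 e4 y]])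
  show "smooth_fun_on S e1" "smooth_fun_on S e2" "smooth_fun_on S e3" "smooth_fun_on S e4"
    by (simp_all add: smooth_fun_on_def e1 e2 e3 e4)
qed

lemma smooth_k1: "smooth_fun_on S k1"
proof (rule smooth_fun_on_cong[OF open_S])
  show "smooth_fun_on S (\<lambda>s. e2 s \<bullet> curve_deriv 2 x s)"
    using smooth_frame(2) smooth_curve_deriv[of 2] by (simp add: smooth_fun_on_def n_diff_on_inner)
  show "\<And>s. s \<in> S \<Longrightarrow> k1 s = e2 s \<bullet> curve_deriv 2 x s"
    by (simp add: frenet_k1_def unit_speed[unfolded One_nat_def])
qed

lemma k2_eq: "s \<in> S \<Longrightarrow> k2 s = (e3 s \<bullet> curve_deriv 3 x s) / k1 s"
  by (simp add: frenet_k2_def unit_speed[unfolded One_nat_def])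

lemma k3_eq: "s \<in> S \<Longrightarrow> k3 s = (e4 s \<bullet> curve_deriv 4 x s) / (k1 s * k2 s)"
  by (simp add: frenet_k3_def unit_speed[unfolded One_nat_def])

lemma V1_derivative: "s \<in> S \<Longrightarrow> (e1 has_vector_derivative k1 s *\<^sub>R e2 s) (at s)"
  using has_vector_derivative_transform_within_open[OF curve_deriv_derivatives(1) open_S] V1_eq
    curve_deriv_2 by metis

text \<open>The derivative of \<open>e2\<close> is left unevaluated on purpose: comparison with the
  definition of \<open>k2\<close> and with the orthogonality of \<open>e4\<close> will reveal its
  components.\<close>

lemma curve_deriv_3:
  assumes s: "s \<in> S"
  shows "curve_deriv 3 x s = k1 s *\<^sub>R vector_derivative e2 (at s) + deriv k1 s *\<^sub>R e2 s"
proof -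
  have "((\<lambda>s. k1 s *\<^sub>R e2 s) has_vector_derivative
      k1 s *\<^sub>R vector_derivative e2 (at s) + deriv k1 s *\<^sub>R e2 s) (at s)"
    by (intro bounded_bilinear.has_vector_derivative[OF bounded_bilinear_scaleR] s
        smooth_fun_on_deriv(2)[OF open_S smooth_k1]
        smooth_fun_on_vector_derivative(2)[OF open_S smooth_frame(2)])
  from curve_deriv_SucI[OF open_S s _ this, of 2 x] show ?thesis
    by (simp add: curve_deriv_2)
qed

text \<open>The components along \<open>e1\<close> and \<open>e2\<close> come from orthonormality.
  Those along \<open>e3\<close> and \<open>e4\<close> are read off the third derivative, where they
  are multiplied by \<open>k1\<close>, which is nonzero.\<close>

lemma V2_derivative:
  assumes s: "s \<in> S"
  shows "(e2 has_vector_derivative - k1 s *\<^sub>R e1 s + k2 s *\<^sub>R e3 s) (at s)"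
proof -
  define d where "d = vector_derivative e2 (at s)"
  have d: "(e2 has_vector_derivative d) (at s)"
    unfolding d_def by (rule smooth_fun_on_vector_derivative(2)[OF open_S smooth_frame(2) s])
  note o = frame_inner[OF frame[OF s]]
  have "d \<bullet> e2 s + e2 s \<bullet> d = 0"
    by (rule inner_const_derivative[OF open_S s _ d d, of 1]) (rule frame_inner[OF frame])
  then have 2: "d \<bullet> e2 s = 0" by (simp add: inner_commute)
  have "d \<bullet> e1 s + e2 s \<bullet> (k1 s *\<^sub>R e2 s) = 0"
    by (rule inner_const_derivative[OF open_S s _ d V1_derivative[OF s], of 0]) (rule frame_inner[OF frame])
  then have 1: "d \<bullet> e1 s = - k1 s" using o by simp
  have 3: "d \<bullet> e3 s = k2 s"
    using k2_eq[OF s] k1_nonzero[OF s] o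
    by (simp add: curve_deriv_3[OF s] d_def inner_add_right inner_commute)
  have 4: "d \<bullet> e4 s = 0"
    using V4_orthogonal(2)[OF s] k1_nonzero[OF s] o
    by (simp add: curve_deriv_3[OF s] d_def inner_add_right inner_commute)
  have "d = - k1 s *\<^sub>R e1 s + k2 s *\<^sub>R e3 s"
    using frame_expand[OF frame[OF s], of d] by (simp add: 1 2 3 4)
  then show ?thesis using d by simp
qed

lemma curve_deriv_3':
  "s \<in> S \<Longrightarrow> curve_deriv 3 x s = - (k1 s)\<^sup>2 *\<^sub>R e1 s + deriv k1 s *\<^sub>R e2 s + (k1 s * k2 s) *\<^sub>R e3 s"
  by (simp add: curve_deriv_3 vector_derivative_at[OF V2_derivative] power2_eq_square algebra_simps)

text \<open>With \<open>k2 s = 0\<close> the first three derivatives would lie in the plane of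
  \<open>e1 s\<close> and \<open>e2 s\<close>.\<close>

lemma k2_nonzero:
  assumes s: "s \<in> S"
  shows "k2 s \<noteq> 0"
proof
  assume "k2 s = 0"
  then have "ternary (curve_deriv 1 x s) (curve_deriv 2 x s) (curve_deriv 3 x s) = 0"
    unfolding curve_deriv_3'[OF s] curve_deriv_2[OF s] V1_eq[OF s, symmetric]
    by (simp only: ternary_add ternary_scaleR ternary_same) simp
  then show False using ternary_curve_deriv_nonzero[OF s] by simp
qed

lemma smooth_k2: "smooth_fun_on S k2"
proof (rule smooth_fun_on_cong[OF open_S _ k2_eq])
  show "smooth_fun_on S (\<lambda>s. (e3 s \<bullet> curve_deriv 3 x s) / k1 s)"
    using smooth_frame(3) smooth_curve_deriv[of 3] smooth_k1
    by (simp add: smooth_fun_on_def n_diff_on_inner n_diff_on_divide k1_nonzero)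
qed

lemma smooth_k3: "smooth_fun_on S k3"
proof (rule smooth_fun_on_cong[OF open_S _ k3_eq])
  show "smooth_fun_on S (\<lambda>s. (e4 s \<bullet> curve_deriv 4 x s) / (k1 s * k2 s))"
    using smooth_frame(4) smooth_curve_deriv[of 4] smooth_k1 smooth_k2
    by (simp add: smooth_fun_on_def n_diff_on_inner n_diff_on_divide n_diff_on_mult k1_nonzero k2_nonzero)
qed

text \<open>\<open>k3\<close> is defined through the fourth derivative of \<open>x\<close>.
  Differentiating the orthogonality of \<open>e4\<close> to the third derivative brings it in
  without computing it. The derivative of \<open>e3\<close> then follows by skew symmetry alone,
  which is why \<open>e4\<close> precedes \<open>e3\<close>.\<close>

lemma V4_derivative:
  assumes s: "s \<in> S"
  shows "(e4 has_vector_derivative - k3 s *\<^sub>R e3 s) (at s)"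
proof -
  define d where "d = vector_derivative e4 (at s)"
  have d: "(e4 has_vector_derivative d) (at s)"
    unfolding d_def by (rule smooth_fun_on_vector_derivative(2)[OF open_S smooth_frame(4) s])
  note o = frame_inner[OF frame[OF s]]
  have "d \<bullet> e4 s + e4 s \<bullet> d = 0"
    by (rule inner_const_derivative[OF open_S s _ d d, of 1]) (rule frame_inner[OF frame])
  then have 4: "d \<bullet> e4 s = 0" by (simp add: inner_commute)
  have "d \<bullet> e1 s + e4 s \<bullet> (k1 s *\<^sub>R e2 s) = 0"
    by (rule inner_const_derivative[OF open_S s _ d V1_derivative[OF s], of 0]) (rule frame_inner[OF frame])
  then have 1: "d \<bullet> e1 s = 0" using o by simp
  have "d \<bullet> e2 s + e4 s \<bullet> (- k1 s *\<^sub>R e1 s + k2 s *\<^sub>R e3 s) = 0"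
    by (rule inner_const_derivative[OF open_S s _ d V2_derivative[OF s], of 0]) (rule frame_inner[OF frame])
  then have 2: "d \<bullet> e2 s = 0" using o by (simp add: inner_diff_right inner_add_right)
  have "d \<bullet> curve_deriv 3 x s + e4 s \<bullet> curve_deriv 4 x s = 0"
    by (rule inner_const_derivative[OF open_S s _ d curve_deriv_derivatives(3)[OF s], of 0])
      (rule V4_orthogonal)
  then have "(k1 s * k2 s) * (d \<bullet> e3 s) + e4 s \<bullet> curve_deriv 4 x s = 0"
    by (simp add: curve_deriv_3'[OF s] inner_add_right inner_diff_right 1 2)
  then have 3: "d \<bullet> e3 s = - k3 s"
    using k1_nonzero[OF s] k2_nonzero[OF s] by (simp add: k3_eq[OF s] field_simps)
  have "d = - k3 s *\<^sub>R e3 s"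
    using frame_expand[OF frame[OF s], of d] by (simp add: 1 2 3 4)
  then show ?thesis using d by simp
qed

lemma V3_derivative:
  assumes s: "s \<in> S"
  shows "(e3 has_vector_derivative - k2 s *\<^sub>R e2 s + k3 s *\<^sub>R e4 s) (at s)"
proof -
  define d where "d = vector_derivative e3 (at s)"
  have d: "(e3 has_vector_derivative d) (at s)"
    unfolding d_def by (rule smooth_fun_on_vector_derivative(2)[OF open_S smooth_frame(3) s])
  note o = frame_inner[OF frame[OF s]]
  have "d \<bullet> e3 s + e3 s \<bullet> d = 0"
    by (rule inner_const_derivative[OF open_S s _ d d, of 1]) (rule frame_inner[OF frame])
  then have 3: "d \<bullet> e3 s = 0" by (simp add: inner_commute)
  have "d \<bullet> e1 s + e3 s \<bullet> (k1 s *\<^sub>R e2 s) = 0"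
    by (rule inner_const_derivative[OF open_S s _ d V1_derivative[OF s], of 0]) (rule frame_inner[OF frame])
  then have 1: "d \<bullet> e1 s = 0" using o by simp
  have "d \<bullet> e2 s + e3 s \<bullet> (- k1 s *\<^sub>R e1 s + k2 s *\<^sub>R e3 s) = 0"
    by (rule inner_const_derivative[OF open_S s _ d V2_derivative[OF s], of 0]) (rule frame_inner[OF frame])
  then have 2: "d \<bullet> e2 s = - k2 s" using o by (simp add: inner_diff_right inner_add_right)
  have "d \<bullet> e4 s + e3 s \<bullet> (- k3 s *\<^sub>R e3 s) = 0"
    by (rule inner_const_derivative[OF open_S s _ d V4_derivative[OF s], of 0]) (rule frame_inner[OF frame])
  then have 4: "d \<bullet> e4 s = k3 s" using o by simp
  have "d = - k2 s *\<^sub>R e2 s + k3 s *\<^sub>R e4 s"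
    using frame_expand[OF frame[OF s], of d] by (simp add: 1 2 3 4)
  then show ?thesis using d by simp
qed

end

subsection \<open>The involute\<close>

text \<open>Normalisation keeps only the sign of a scalar factor: \<open>p\<^sup>2\<close> and
  \<open>p\<^sup>2 / W\<close> leave no trace, while \<open>p / sqrt Q\<close> leaves
  \<open>sgn p\<close>.\<close>

lemma sgn_eq_scaled:
  assumes "w = r *\<^sub>R u" "norm u = m"
  shows "sgn w = (sgn r / m) *\<^sub>R u"
  using assms by (simp add: sgn_scaleR sgn_div_norm divide_inverse)

text \<open>In the application \<open>p\<close> is \<open>\<phi>\<close>, and \<open>a\<close>, \<open>b\<close>, \<open>d\<close> are \<open>A\<close>, \<open>C\<close>, \<open>D\<close>. The coefficients \<open>q\<close>
  and \<open>r\<close> along the tangent do not influence the result.\<close>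

lemma frenet_apparatus_of_coefficients:
  fixes a b d p q r k1 k2 :: real
  assumes frame: "frame e1 e2 e3 e4"
    and y1: "curve_deriv 1 y s = p *\<^sub>R e2"
    and y2: "curve_deriv 2 y s = - (p * k1) *\<^sub>R e1 + q *\<^sub>R e2 + (p * k2) *\<^sub>R e3"
    and y3: "curve_deriv 3 y s = - a *\<^sub>R e1 + r *\<^sub>R e2 + b *\<^sub>R e3 + d *\<^sub>R e4"
    and E: "E = k2 * a - k1 * b" and Q: "Q = k1\<^sup>2 + k2\<^sup>2" and W: "W = sqrt (d\<^sup>2 * Q + E\<^sup>2)"
    and p: "p \<noteq> 0" and W0: "W \<noteq> 0"
  shows "ternary (curve_deriv 1 y s) (curve_deriv 2 y s) (curve_deriv 3 y s) \<noteq> 0"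
    and "frenet_V1 y s = sgn p *\<^sub>R e2"
    and "frenet_V2 y s = (sgn p / sqrt Q) *\<^sub>R (- k1 *\<^sub>R e1 + k2 *\<^sub>R e3)"
    and "frenet_V3 y s = (1 / (W * sqrt Q)) *\<^sub>R (- (E * k2) *\<^sub>R e1 - (E * k1) *\<^sub>R e3 + (d * Q) *\<^sub>R e4)"
    and "frenet_V4 y s = (1 / W) *\<^sub>R (- (d * k2) *\<^sub>R e1 - (d * k1) *\<^sub>R e3 - E *\<^sub>R e4)"
    and "frenet_k1 y s = sqrt Q / \<bar>p\<bar>"
    and "frenet_k2 y s = W / (p\<^sup>2 * Q)"
proof -
  \<comment> \<open>If \<open>Q\<close> were 0, then \<open>k1\<close>, \<open>k2\<close> and hence
    \<open>E\<close> and \<open>W\<close> would vanish.\<close>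
  have "Q \<noteq> 0"
    using W0 by (auto simp: E Q W sum_power2_eq_zero_iff)
  then have Q0: "Q > 0"
    unfolding Q by (metis less_le sum_power2_ge_zero)
  then have sq: "sqrt Q \<noteq> 0" "sqrt Q * sqrt Q = Q" by simp_all
  have W2: "W\<^sup>2 = d\<^sup>2 * Q + E\<^sup>2" using Q0 by (simp add: W)
  have Wp: "W > 0" using W0 Q0 by (simp add: W less_le)
  have p2: "sgn (p\<^sup>2) = 1" "sgn (p\<^sup>2 / W) = 1" using p Wp by (simp_all add: sgn_if)
  note comb = ternary_frame_combination[OF frame]
  note nrm = norm_frame_combination[OF frame]
  note inn = inner_frame_combination[OF frame]
  \<comment> \<open>Zero coefficients are supplied to give every vector the four-term shape of the
    coordinate formulas.\<close>
  have Y1: "curve_deriv 1 y s = 0 *\<^sub>R e1 + p *\<^sub>R e2 + 0 *\<^sub>R e3 + 0 *\<^sub>R e4"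
    using y1 by simp
  have Y2: "curve_deriv 2 y s = (- (p * k1)) *\<^sub>R e1 + q *\<^sub>R e2 + (p * k2) *\<^sub>R e3 + 0 *\<^sub>R e4"
    using y2 by simp
  have Y3: "curve_deriv 3 y s = (- a) *\<^sub>R e1 + r *\<^sub>R e2 + b *\<^sub>R e3 + d *\<^sub>R e4"
    using y3 by simp
  have norm1: "norm (curve_deriv 1 y s) = \<bar>p\<bar>"
    using frame_inner(2)[OF frame] by (simp only: y1 norm_scaleR) (simp add: norm_eq_sqrt_inner)
  show "frenet_V1 y s = sgn p *\<^sub>R e2"
    unfolding frenet_V1_def y1 sgn_scaleR
    using frame_inner(2)[OF frame] by (simp add: sgn_div_norm norm_eq_sqrt_inner)
  \<comment> \<open>The first factor is along \<open>e2\<close>, so only minors without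
    \<open>e2\<close> coordinates survive. \<open>q\<close> and \<open>r\<close> disappear, and the
    second and third factors contribute \<open>p\<close> and \<open>E\<close>, \<open>d\<close> as
    signed minors.\<close>
  have T4: "ternary (curve_deriv 1 y s) (curve_deriv 2 y s) (curve_deriv 3 y s) =
      p\<^sup>2 *\<^sub>R (- (d * k2) *\<^sub>R e1 + 0 *\<^sub>R e2 + (- (d * k1)) *\<^sub>R e3 + (- E) *\<^sub>R e4)"
    unfolding Y1 Y2 Y3 comb by (simp add: E power2_eq_square algebra_simps)
  have N4: "norm (- (d * k2) *\<^sub>R e1 + 0 *\<^sub>R e2 + (- (d * k1)) *\<^sub>R e3 + (- E) *\<^sub>R e4) = W"
    unfolding nrm W Q by (simp add: power2_eq_square algebra_simps)
  show "ternary (curve_deriv 1 y s) (curve_deriv 2 y s) (curve_deriv 3 y s) \<noteq> 0"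
    unfolding T4 using N4 W0 p by (metis norm_zero scaleR_eq_0_iff power_not_zero)
  have V4': "frenet_V4 y s = (1 / W) *\<^sub>R (- (d * k2) *\<^sub>R e1 + 0 *\<^sub>R e2 + (- (d * k1)) *\<^sub>R e3 + (- E) *\<^sub>R e4)"
    unfolding frenet_V4_def sgn_eq_scaled[OF T4 N4] p2 ..
  then show "frenet_V4 y s = (1 / W) *\<^sub>R (- (d * k2) *\<^sub>R e1 - (d * k1) *\<^sub>R e3 - E *\<^sub>R e4)"
    by simp
  have T3: "ternary (curve_deriv 1 y s) (frenet_V4 y s) (curve_deriv 2 y s) =
      (p\<^sup>2 / W) *\<^sub>R (- (E * k2) *\<^sub>R e1 + 0 *\<^sub>R e2 + (- (E * k1)) *\<^sub>R e3 + (d * Q) *\<^sub>R e4)"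
    unfolding V4' ternary_scaleR Y1 Y2 comb by (simp add: Q power2_eq_square algebra_simps)
  \<comment> \<open>The left side is \<open>Q * (E\<^sup>2 + d\<^sup>2 * Q)\<close>.\<close>
  have "(E * k2)\<^sup>2 + (E * k1)\<^sup>2 + (d * Q)\<^sup>2 = W\<^sup>2 * Q"
    unfolding W2 Q by algebra
  then have N3: "norm (- (E * k2) *\<^sub>R e1 + 0 *\<^sub>R e2 + (- (E * k1)) *\<^sub>R e3 + (d * Q) *\<^sub>R e4) = W * sqrt Q"
    unfolding nrm using Wp by (simp add: real_sqrt_mult)
  have V3': "frenet_V3 y s = (1 / (W * sqrt Q)) *\<^sub>R
      (- (E * k2) *\<^sub>R e1 + 0 *\<^sub>R e2 + (- (E * k1)) *\<^sub>R e3 + (d * Q) *\<^sub>R e4)"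
    unfolding frenet_V3_def sgn_eq_scaled[OF T3 N3] p2 ..
  then show "frenet_V3 y s = (1 / (W * sqrt Q)) *\<^sub>R
      (- (E * k2) *\<^sub>R e1 - (E * k1) *\<^sub>R e3 + (d * Q) *\<^sub>R e4)"
    by simp
  \<comment> \<open>Both coefficients contain \<open>E\<^sup>2 + d\<^sup>2 * Q\<close>, that is
    \<open>W\<^sup>2\<close>, which cancels the factors \<open>1 / W\<close> of the third and fourth
    frame vectors.\<close>
  have "ternary (frenet_V3 y s) (frenet_V4 y s) (curve_deriv 1 y s) =
      (1 / (W * sqrt Q) * (1 / W)) *\<^sub>R
        ((- (p * k1 * W\<^sup>2)) *\<^sub>R e1 + 0 *\<^sub>R e2 + (p * k2 * W\<^sup>2) *\<^sub>R e3 + 0 *\<^sub>R e4)"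
    unfolding V3' V4' ternary_scaleR Y1 comb W2 by (simp add: power2_eq_square algebra_simps)
  also have "\<dots> = (p / sqrt Q) *\<^sub>R ((- k1) *\<^sub>R e1 + 0 *\<^sub>R e2 + k2 *\<^sub>R e3 + 0 *\<^sub>R e4)"
    using W0 by (simp add: power2_eq_square scaleR_diff_right)
  finally have T2: "ternary (frenet_V3 y s) (frenet_V4 y s) (curve_deriv 1 y s) =
      (p / sqrt Q) *\<^sub>R ((- k1) *\<^sub>R e1 + 0 *\<^sub>R e2 + k2 *\<^sub>R e3 + 0 *\<^sub>R e4)" .
  have N2: "norm ((- k1) *\<^sub>R e1 + 0 *\<^sub>R e2 + k2 *\<^sub>R e3 + 0 *\<^sub>R e4) = sqrt Q"
    unfolding nrm by (simp add: Q)
  have sp: "sgn (p / sqrt Q) = sgn p" using Q0 by (simp add: sgn_divide)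
  have V2': "frenet_V2 y s = (sgn p / sqrt Q) *\<^sub>R ((- k1) *\<^sub>R e1 + 0 *\<^sub>R e2 + k2 *\<^sub>R e3 + 0 *\<^sub>R e4)"
    unfolding frenet_V2_def sgn_eq_scaled[OF T2 N2] sp ..
  then show "frenet_V2 y s = (sgn p / sqrt Q) *\<^sub>R (- k1 *\<^sub>R e1 + k2 *\<^sub>R e3)"
    by simp
  have "frenet_V2 y s \<bullet> curve_deriv 2 y s = sgn p * p * (Q / sqrt Q)"
    unfolding V2' Y2 inner_scaleR_left inn by (simp add: Q power2_eq_square algebra_simps)
  also have "\<dots> = \<bar>p\<bar> * sqrt Q"
    using Q0 by (simp add: real_div_sqrt sgn_if)
  finally show k1: "frenet_k1 y s = sqrt Q / \<bar>p\<bar>"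
    unfolding frenet_k1_def norm1 using p by (simp add: power2_eq_square field_simps)
  have "frenet_V3 y s \<bullet> curve_deriv 3 y s = W\<^sup>2 / (W * sqrt Q)"
    unfolding V3' Y3 inner_scaleR_left inn W2
    by (simp add: E power2_eq_square algebra_simps add_divide_distrib diff_divide_distrib)
  also have "\<dots> = W / sqrt Q" using W0 by (simp add: power2_eq_square)
  finally have "frenet_k2 y s = W / sqrt Q / (\<bar>p\<bar> ^ 3 * (sqrt Q / \<bar>p\<bar>))"
    unfolding frenet_k2_def norm1 k1 by simp
  also have "\<bar>p\<bar> ^ 3 * (sqrt Q / \<bar>p\<bar>) = p\<^sup>2 * sqrt Q"
    using p by (simp add: power3_eq_cube power2_eq_square)
  also have "W / sqrt Q / (p\<^sup>2 * sqrt Q) = W / (p\<^sup>2 * (sqrt Q * sqrt Q))"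
    by (simp only: divide_divide_eq_left mult_ac)
  finally show "frenet_k2 y s = W / (p\<^sup>2 * Q)"
    unfolding sq(2) .
qed

section \<open>Differentiation in the moving frame of \<open>x\<close>\<close>

context unit_speed_frenet_curve
begin

text \<open>In moving coordinates, differentiation is the componentwise derivative plus the action
  of the skew Frenet matrix. Each further derivative of the involute is one application.\<close>

lemma frame_combination_derivative:
  assumes s: "s \<in> S"
    and a: "(a1 has_vector_derivative a1') (at s)" "(a2 has_vector_derivative a2') (at s)"
      "(a3 has_vector_derivative a3') (at s)" "(a4 has_vector_derivative a4') (at s)"
  shows "((\<lambda>s. a1 s *\<^sub>R e1 s + a2 s *\<^sub>R e2 s + a3 s *\<^sub>R e3 s + a4 s *\<^sub>R e4 s) has_vector_derivative
      (a1' - k1 s * a2 s) *\<^sub>R e1 s + (a2' + k1 s * a1 s - k2 s * a3 s) *\<^sub>R e2 s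
      + (a3' + k2 s * a2 s - k3 s * a4 s) *\<^sub>R e3 s + (a4' + k3 s * a3 s) *\<^sub>R e4 s) (at s)"
proof -
  note sc = bounded_bilinear.has_vector_derivative[OF bounded_bilinear_scaleR]
  show ?thesis
    using has_vector_derivative_add[OF has_vector_derivative_add[OF has_vector_derivative_add[OF
          sc[OF a(1) V1_derivative[OF s]] sc[OF a(2) V2_derivative[OF s]]]
          sc[OF a(3) V3_derivative[OF s]]] sc[OF a(4) V4_derivative[OF s]]]
    by (simp add: algebra_simps)
qed

text \<open>The derivative -1 of \<open>c - s\<close> contributes \<open>- e1 s\<close>, which
  cancels the unit tangent of \<open>x\<close>.\<close>

lemma involute_derivative:
  assumes s: "s \<in> S"
  shows "(involute c x has_vector_derivative ((c - s) * k1 s) *\<^sub>R e2 s) (at s)"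
proof -
  have "((\<lambda>s. x s + (c - s) *\<^sub>R e1 s) has_vector_derivative
      curve_deriv 1 x s + ((c - s) *\<^sub>R (k1 s *\<^sub>R e2 s) + (0 - 1) *\<^sub>R e1 s)) (at s)"
    using curve_deriv_derivative[OF s, of 0]
    by (intro has_vector_derivative_add has_vector_derivative_diff has_vector_derivative_const
        has_vector_derivative_id bounded_bilinear.has_vector_derivative[OF bounded_bilinear_scaleR]
        V1_derivative[OF s]) (simp add: curve_deriv_0)
  then show ?thesis by (simp add: involute_def[abs_def] V1_eq[OF s])
qed

lemma smooth_involute: "smooth_fun_on S (involute c x)"
  using smooth_x smooth_frame(1)
  by (simp add: involute_def[abs_def] smooth_fun_on_def n_diff_on_add n_diff_on_scaleR n_diff_on_diff
      n_diff_on_const n_diff_on_id)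

end

text \<open>The involute has velocity \<open>\<phi> s *\<^sub>R V2 s\<close>, where \<phi> may be
  negative, hence the factor \<open>sgn (\<phi> s)\<close> in the first two frame vectors; the
  directions of the other two carry \<phi> squared. The relative signs in the fourth vector are
  those that make it orthogonal to the second and third derivatives of \<open>xb\<close>, and the
  signs in the third curvature follow from them.\<close>

theorem proposition7:
  fixes x xb V1 V2 V3 V4 :: "real \<Rightarrow> real^4"
    and \<kappa>1 \<kappa>2 \<kappa>3 \<phi> A C D W :: "real \<Rightarrow> real"
    and I :: "real set" and c :: real
  assumes "open I" and "is_interval I"
    and "frenet_curve_on I x"
    and "\<forall>s\<in>I. norm (curve_deriv 1 x s) = 1"
    and "V1 = frenet_V1 x" and "V2 = frenet_V2 x" and "V3 = frenet_V3 x" and "V4 = frenet_V4 x"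
    and "\<kappa>1 = frenet_k1 x" and "\<kappa>2 = frenet_k2 x" and "\<kappa>3 = frenet_k3 x"
    and "xb = involute c x"
    and "\<phi> = (\<lambda>s. (c - s) * \<kappa>1 s)"
    and "A = (\<lambda>s. deriv \<kappa>1 s * \<phi> s + 2 * \<kappa>1 s * deriv \<phi> s)"
    and "C = (\<lambda>s. deriv \<kappa>2 s * \<phi> s + 2 * \<kappa>2 s * deriv \<phi> s)"
    and "D = (\<lambda>s. \<kappa>2 s * \<kappa>3 s * \<phi> s)"
    and "W = (\<lambda>s. sqrt ((D s)^2 * ((\<kappa>1 s)^2 + (\<kappa>2 s)^2) + (\<kappa>1 s * C s - \<kappa>2 s * A s)^2))"
    and "\<forall>s\<in>I. \<phi> s \<noteq> 0" and "\<forall>s\<in>I. W s \<noteq> 0"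
  shows "frenet_curve_on I xb \<and>
    (\<forall>s\<in>I.
      W s = \<bar>\<phi> s\<bar> * sqrt ((\<kappa>2 s)^2 * (\<kappa>3 s)^2 * ((\<kappa>1 s)^2 + (\<kappa>2 s)^2)
              + (\<kappa>1 s * deriv \<kappa>2 s - \<kappa>2 s * deriv \<kappa>1 s)^2) \<and>
      frenet_V1 xb s = sgn (\<phi> s) *\<^sub>R V2 s \<and>
      frenet_V2 xb s = (sgn (\<phi> s) / sqrt ((\<kappa>1 s)^2 + (\<kappa>2 s)^2)) *\<^sub>R
          (- \<kappa>1 s *\<^sub>R V1 s + \<kappa>2 s *\<^sub>R V3 s) \<and>
      frenet_V3 xb s = (1 / (W s * sqrt ((\<kappa>1 s)^2 + (\<kappa>2 s)^2))) *\<^sub>R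
          (- ((\<kappa>2 s * A s - \<kappa>1 s * C s) * \<kappa>2 s) *\<^sub>R V1 s
           - ((\<kappa>2 s * A s - \<kappa>1 s * C s) * \<kappa>1 s) *\<^sub>R V3 s
           + (D s * ((\<kappa>1 s)^2 + (\<kappa>2 s)^2)) *\<^sub>R V4 s) \<and>
      frenet_V4 xb s = (1 / W s) *\<^sub>R
          (- (D s * \<kappa>2 s) *\<^sub>R V1 s - (D s * \<kappa>1 s) *\<^sub>R V3 s
           - (\<kappa>2 s * A s - \<kappa>1 s * C s) *\<^sub>R V4 s) \<and>
      frenet_k1 xb s = sqrt ((\<kappa>1 s)^2 + (\<kappa>2 s)^2) / \<bar>\<phi> s\<bar> \<and>
      frenet_k2 xb s = W s / ((\<phi> s)^2 * ((\<kappa>1 s)^2 + (\<kappa>2 s)^2)) \<and>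
      frenet_k3 xb s =
        - (((\<kappa>2 s * A s - \<kappa>1 s * C s) * (\<kappa>3 s * C s + deriv D s)
            - D s * (\<kappa>2 s * deriv A s - \<kappa>1 s * deriv C s) - (D s)^2 * \<kappa>1 s * \<kappa>3 s)
           / (W s * (\<phi> s)^4 * frenet_k1 xb s * frenet_k2 xb s)))"
proof -
  interpret unit_speed_frenet_curve I x
    using assms(1,3,4) by unfold_locales auto
  note I = \<open>open I\<close>
  have smooth: "smooth_fun_on I \<kappa>1" "smooth_fun_on I \<kappa>2" "smooth_fun_on I \<kappa>3"
    using smooth_k1 smooth_k2 smooth_k3 assms(9-11) by auto
  note combine = n_diff_on_add n_diff_on_diff n_diff_on_mult n_diff_on_power n_diff_on_const n_diff_on_id
  have \<phi>: "smooth_fun_on I \<phi>"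
    using smooth by (simp add: smooth_fun_on_def assms(13) combine)
  note \<phi>' = smooth_fun_on_deriv(1)[OF I \<phi>]
  note \<kappa>' = smooth[THEN smooth_fun_on_deriv(1)[OF I]]
  \<comment> \<open>The \<open>V2\<close> coefficient of the third derivative: \<phi>'' from the
    coefficient itself, the rest from the turning of \<open>V1\<close> and \<open>V3\<close> towards
    \<open>V2\<close>.\<close>
  define B where "B = (\<lambda>s. deriv (deriv \<phi>) s - ((\<kappa>1 s)\<^sup>2 + (\<kappa>2 s)\<^sup>2) * \<phi> s)"
  have A: "smooth_fun_on I A"
    using smooth \<phi> \<phi>' \<kappa>' by (simp add: smooth_fun_on_def assms(14) combine)
  have C: "smooth_fun_on I C"
    using smooth \<phi> \<phi>' \<kappa>' by (simp add: smooth_fun_on_def assms(15) combine)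
  have D: "smooth_fun_on I D"
    using smooth \<phi> by (simp add: smooth_fun_on_def assms(16) combine)
  have B: "smooth_fun_on I B"
    using smooth \<phi> smooth_fun_on_deriv(1)[OF I \<phi>'] by (simp add: smooth_fun_on_def B_def combine)
  note der = smooth_fun_on_deriv(2)[OF I]
  note fold = assms(5-11)[symmetric]
  have d1: "curve_deriv 1 xb s = \<phi> s *\<^sub>R V2 s" if s: "s \<in> I" for s
    using vector_derivative_at[OF involute_derivative[OF s, of c]]
    by (simp add: curve_deriv_Suc curve_deriv_0 assms(6,9,12,13))
  have d2: "curve_deriv 2 xb s = - (\<phi> s * \<kappa>1 s) *\<^sub>R V1 s + deriv \<phi> s *\<^sub>R V2 s + (\<phi> s * \<kappa>2 s) *\<^sub>R V3 s"
    if s: "s \<in> I" for s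
  proof -
    have "((\<lambda>s. 0 *\<^sub>R V1 s + \<phi> s *\<^sub>R V2 s + 0 *\<^sub>R V3 s + 0 *\<^sub>R V4 s) has_vector_derivative
      (0 - \<kappa>1 s * \<phi> s) *\<^sub>R V1 s + (deriv \<phi> s + \<kappa>1 s * 0 - \<kappa>2 s * 0) *\<^sub>R V2 s
      + (0 + \<kappa>2 s * \<phi> s - \<kappa>3 s * 0) *\<^sub>R V3 s + (0 + \<kappa>3 s * 0) *\<^sub>R V4 s) (at s)"
      unfolding assms(5-11)
      by (rule frame_combination_derivative[OF s]) (auto intro: der \<phi> s)
    from curve_deriv_SucI[OF I s _ this, of 1 xb] show ?thesis
      by (simp add: d1[unfolded One_nat_def] numeral_2_eq_2 mult.commute)
  qed
  \<comment> \<open>The factor 2 in \<open>A\<close> and \<open>C\<close> arises because \<phi>'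
    appears twice: from differentiating \<phi>\<kappa>1 and \<phi>\<kappa>2, and from
    \<open>V2\<close> turning towards \<open>V1\<close> and \<open>V3\<close>. \<open>D\<close>
    comes from \<open>V3\<close> turning towards \<open>V4\<close>.\<close>
  have d3: "curve_deriv 3 xb s = - A s *\<^sub>R V1 s + B s *\<^sub>R V2 s + C s *\<^sub>R V3 s + D s *\<^sub>R V4 s"
    if s: "s \<in> I" for s
  proof -
    have prod: "((\<lambda>s. \<phi> s * k s) has_vector_derivative \<phi> s * deriv k s + deriv \<phi> s * k s) (at s)"
      if "smooth_fun_on I k" for k
      by (rule bounded_bilinear.has_vector_derivative[OF bounded_bilinear_mult der[OF \<phi> s] der[OF that s]])
    have "((\<lambda>s. - (\<phi> s * \<kappa>1 s) *\<^sub>R V1 s + deriv \<phi> s *\<^sub>R V2 s + (\<phi> s * \<kappa>2 s) *\<^sub>R V3 s + 0 *\<^sub>R V4 s)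
      has_vector_derivative
      (- (\<phi> s * deriv \<kappa>1 s + deriv \<phi> s * \<kappa>1 s) - \<kappa>1 s * deriv \<phi> s) *\<^sub>R V1 s
      + (deriv (deriv \<phi>) s + \<kappa>1 s * (- (\<phi> s * \<kappa>1 s)) - \<kappa>2 s * (\<phi> s * \<kappa>2 s)) *\<^sub>R V2 s
      + ((\<phi> s * deriv \<kappa>2 s + deriv \<phi> s * \<kappa>2 s) + \<kappa>2 s * deriv \<phi> s - \<kappa>3 s * 0) *\<^sub>R V3 s
      + (0 + \<kappa>3 s * (\<phi> s * \<kappa>2 s)) *\<^sub>R V4 s) (at s)"
      unfolding assms(5-8) unfolding assms(9-11)
      by (rule frame_combination_derivative[OF s], unfold fold)
        (intro has_vector_derivative_minus has_vector_derivative_const prod smooth der \<phi>' s)+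
    from curve_deriv_SucI[OF I s _ this, of 2 xb] show ?thesis
      by (simp add: d2 assms(14-16) B_def power2_eq_square
          algebra_simps)
  qed
  have d4: "curve_deriv 4 xb s = - (deriv A s + \<kappa>1 s * B s) *\<^sub>R V1 s
      + (deriv B s - \<kappa>1 s * A s - \<kappa>2 s * C s) *\<^sub>R V2 s
      + (deriv C s + \<kappa>2 s * B s - \<kappa>3 s * D s) *\<^sub>R V3 s + (deriv D s + \<kappa>3 s * C s) *\<^sub>R V4 s"
    if s: "s \<in> I" for s
  proof -
    have "((\<lambda>s. - A s *\<^sub>R V1 s + B s *\<^sub>R V2 s + C s *\<^sub>R V3 s + D s *\<^sub>R V4 s) has_vector_derivative
      (- deriv A s - \<kappa>1 s * B s) *\<^sub>R V1 s + (deriv B s + \<kappa>1 s * (- A s) - \<kappa>2 s * C s) *\<^sub>R V2 s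
      + (deriv C s + \<kappa>2 s * B s - \<kappa>3 s * D s) *\<^sub>R V3 s + (deriv D s + \<kappa>3 s * C s) *\<^sub>R V4 s) (at s)"
      unfolding assms(5-8) unfolding assms(9-11)
      by (rule frame_combination_derivative[OF s])
        (auto intro!: has_vector_derivative_minus der A B C D s)
    from curve_deriv_SucI[OF I s _ this, of 3 xb] show ?thesis
      by (simp add: d3)
  qed
  have fr: "frame (V1 s) (V2 s) (V3 s) (V4 s)" if "s \<in> I" for s
    using frame[OF that] by (simp add: assms(5-8))
  have W: "W s = sqrt ((D s)\<^sup>2 * ((\<kappa>1 s)\<^sup>2 + (\<kappa>2 s)\<^sup>2) + (\<kappa>2 s * A s - \<kappa>1 s * C s)\<^sup>2)" for s
    by (simp add: assms(17) power2_commute)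
  note app = frenet_apparatus_of_coefficients[OF fr d1 d2 d3 refl refl W]
  have curve: "frenet_curve_on I xb"
    unfolding frenet_curve_on_def smooth_curve_on_iff[OF I]
    by (intro conjI ballI app(1) assms(18,19)[rule_format])
      (simp_all only: assms(12) smooth_involute)
  have W_eq: "W s = \<bar>\<phi> s\<bar> * sqrt ((\<kappa>2 s)^2 * (\<kappa>3 s)^2 * ((\<kappa>1 s)^2 + (\<kappa>2 s)^2)
              + (\<kappa>1 s * deriv \<kappa>2 s - \<kappa>2 s * deriv \<kappa>1 s)^2)" for s
  proof -
    \<comment> \<open>In \<kappa>1 C - \<kappa>2 A the terms 2 \<kappa>1 \<kappa>2 \<phi>' cancel,
      so \<phi> factors out of this difference as it does out of \<open>D\<close>.\<close>
    have "(D s)^2 * ((\<kappa>1 s)^2 + (\<kappa>2 s)^2) + (\<kappa>1 s * C s - \<kappa>2 s * A s)^2 =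
      (\<phi> s)\<^sup>2 * ((\<kappa>2 s)^2 * (\<kappa>3 s)^2 * ((\<kappa>1 s)^2 + (\<kappa>2 s)^2)
              + (\<kappa>1 s * deriv \<kappa>2 s - \<kappa>2 s * deriv \<kappa>1 s)^2)"
      unfolding assms(14-16) by algebra
    then show ?thesis
      unfolding assms(17) by (simp add: real_sqrt_mult)
  qed
  have k3: "frenet_k3 xb s =
        - (((\<kappa>2 s * A s - \<kappa>1 s * C s) * (\<kappa>3 s * C s + deriv D s)
            - D s * (\<kappa>2 s * deriv A s - \<kappa>1 s * deriv C s) - (D s)^2 * \<kappa>1 s * \<kappa>3 s)
           / (W s * (\<phi> s)^4 * frenet_k1 xb s * frenet_k2 xb s))" if s: "s \<in> I" for s
  proof -
    have W0: "\<phi> s \<noteq> 0" "W s \<noteq> 0" using s assms(18,19) by auto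
    have n: "norm (curve_deriv 1 xb s) = \<bar>\<phi> s\<bar>"
      using frame_inner(2)[OF fr[OF s]] by (simp only: d1[OF s] norm_scaleR) (simp add: norm_eq_sqrt_inner)
    have V4: "frenet_V4 xb s = (1 / W s) *\<^sub>R (- (D s * \<kappa>2 s) *\<^sub>R V1 s + 0 *\<^sub>R V2 s
        + (- (D s * \<kappa>1 s)) *\<^sub>R V3 s + (- (\<kappa>2 s * A s - \<kappa>1 s * C s)) *\<^sub>R V4 s)"
      using app(5)[OF s s s s W0] by (simp add: scaleR_diff_left)
    \<comment> \<open>The contributions of \<open>B\<close> through the \<open>V1\<close> and
      \<open>V3\<close> coefficients are opposite and cancel; \<open>deriv B s\<close> sits at
      \<open>V2\<close>, to which this frame vector is orthogonal.\<close>
    have "frenet_V4 xb s \<bullet> curve_deriv 4 xb s =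
        - ((\<kappa>2 s * A s - \<kappa>1 s * C s) * (\<kappa>3 s * C s + deriv D s)
            - D s * (\<kappa>2 s * deriv A s - \<kappa>1 s * deriv C s) - (D s)^2 * \<kappa>1 s * \<kappa>3 s) / W s"
      unfolding V4 d4[OF s] inner_scaleR_left inner_frame_combination[OF fr[OF s]]
      by (simp add: power2_eq_square algebra_simps add_divide_distrib diff_divide_distrib)
    moreover have "\<bar>\<phi> s\<bar> ^ 4 = \<phi> s ^ 4" by simp
    ultimately show ?thesis
      unfolding frenet_k3_def n by (simp only: minus_divide_left divide_divide_eq_left mult.assoc)
  qed
  show ?thesis
    by (intro conjI ballI curve W_eq k3 app(2-7) assms(18,19)[rule_format])
qed

end
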